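(* Let $X$ be a non-negative random variable with probability density function $f$. Assume that $f$ is complex analytic at every point $x$ of $[0,\infty)$ and that $f(0)>0$. Let $n\ge 2$ be a fixed integer, and let $X_1,\dots,X_n$ be independent random variables, each distributed as $X$. If $$X_1+\frac12 X_2+\frac13 X_3+\cdots+\frac1n X_n\ \stackrel{d}{=}\ \max(X_1,\dots,X_n),$$ then $X$ is exponentially distributed with some positive parameter, i.e. there is $\lambda>0$ such that $f(x)=\lambda e^{-\lambda x}$ for all $x\ge 0$.
   Context: The symbol $\stackrel{d}{=}$ denotes equality in distribution. "$f$ is complex analytic at every point of $[0,\infty)$" means that the restriction of $f$ to $[0,\infty)$ extends to a complex analytic function on some open subset of $\mathbb{C}$ containing $[0,\infty)$; in particular $f$ is infinitely differentiable on $[0,\infty)$ (one-sided derivatives at $0$) and has a power series expansion about each point of $[0,\infty)$. The density $f$ is taken to vanish on $(-\infty,0)$, and the cumulative distribution function of $X$ is absolutely continuous with value $0$ at $0$. *)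

theory Defs
  imports "HOL-Probability.Probability" "HOL-Complex_Analysis.Complex_Analysis"
begin

definition complex_analytic_on_nonneg :: "(real \<Rightarrow> real) \<Rightarrow> bool" where
  "complex_analytic_on_nonneg f \<longleftrightarrow>
     (\<exists>g S. open S \<and> complex_of_real ` {0..} \<subseteq> S \<and> g analytic_on S \<and>
            (\<forall>x\<ge>0. g (complex_of_real x) = complex_of_real (f x)))"

end

theory Submission
  imports Defs
begin

text \<open>
  Let \<open>F\<close> be the distribution function of \<open>X\<close> and \<open>\<Psi>(t) = E exp (- X / t)\<close>, which is the integral of
  \<open>F (t u)\<close> against the standard exponential law of \<open>u\<close>. By independence, the hypothesis says that
  \<open>\<Psi>(t) \<Psi>(2 t) \<dots> \<Psi>(n t)\<close> is the integral of \<open>F (t u) ^ n\<close> against the same law. Expanding both sides as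
  \<open>t\<close> tends to \<open>0\<close> (Watson's lemma: \<open>x ^ j\<close> contributes \<open>j! t ^ j\<close>) gives an identity of formal power
  series in the Taylor coefficients of \<open>F\<close> at \<open>0\<close>.
  Every \<open>G\<close> with \<open>G 0 = 0\<close> and \<open>G' = b G + a\<close> solves this identity, and a solution is determined by its
  first two nonzero coefficients: if \<open>F\<close> and \<open>G\<close> first differ at degree \<open>m + 1 \<ge> 3\<close>, comparing
  the coefficients of degree \<open>n + m\<close> forces \<open>(n + m)! n = n! (m + 1)! (1 ^ m + \<dots> + n ^ m)\<close>, which is false.
  Hence \<open>f x = a exp (b x)\<close> near \<open>0\<close>, then on \<open>[0, \<infinity>)\<close> by analytic continuation, and \<open>f\<close> has integral \<open>1\<close>.
\<close>

section \<open>The power series identity\<close>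

text \<open>Raising \<open>m\<close> by one multiplies the left side by
  \<open>(k + m) / (m + 1)\<close>, which is at most \<open>k\<close>, and the right side by exactly
  \<open>k\<close>. Combinatorially, multisets are counted against words.\<close>

lemma choose_le_power: "(k + m - 1) choose m \<le> k ^ m" if "k \<ge> 1"
proof (induction m)
  case (Suc m)
  have "Suc m * ((k + Suc m - 1) choose Suc m) = (k + m) * ((k + m - 1) choose m)"
    using that Suc_times_binomial[of m "k + m - 1"] by simp
  also have "\<dots> \<le> (Suc m * k) * k ^ m"
    using that Suc by (intro mult_mono) (auto simp: algebra_simps)
  finally have "Suc m * ((k + Suc m - 1) choose Suc m) \<le> Suc m * k ^ Suc m"
    by (simp only: power_Suc mult.assoc)
  then show ?case by (simp only: Suc_mult_le_cancel1)
qed simp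

text \<open>The last of these multiplications is already strict: \<open>k + l < Suc l * k\<close> as
  soon as \<open>k \<ge> 2\<close> and \<open>l \<ge> 1\<close>.\<close>

lemma choose_less_power: "(k + m - 1) choose m < k ^ m" if "k \<ge> 2" "m \<ge> 2"
proof -
  obtain l where l: "m = Suc l" "l \<ge> 1" using \<open>m \<ge> 2\<close> by (cases m) auto
  have "Suc l * ((k + m - 1) choose m) = (k + l) * ((k + l - 1) choose l)"
    using that l Suc_times_binomial[of l "k + l - 1"] by simp
  also have "\<dots> \<le> (k + l) * k ^ l"
    using that choose_le_power[of k l] by (intro mult_left_mono) auto
  also have "\<dots> < (Suc l * k) * k ^ l"
    using that l by (intro mult_strict_right_mono) auto
  finally have "Suc l * ((k + m - 1) choose m) < Suc l * k ^ m"
    unfolding l(1) by (simp only: power_Suc mult.assoc)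
  then show ?thesis by (simp only: Suc_mult_less_cancel1)
qed

text \<open>The hockey-stick identity writes the binomial coefficient as a sum over
  \<open>k\<close>, which is compared term by term; the term \<open>k = 2\<close>, present because
  \<open>n \<ge> 2\<close>, is strict.\<close>

lemma choose_less_sum_powers:
  assumes "2 \<le> n" "2 \<le> m"
  shows "(n + m) choose (m + 1) < (\<Sum>k=1..n. k ^ m)"
proof -
  have "(n + m) choose (m + 1) = (\<Sum>k=1..n. (k + m - 1) choose m)"
    by (induction n) (auto simp: add.commute)
  also have "\<dots> < (\<Sum>k=1..n. k ^ m)"
    using assms by (intro sum_strict_mono_ex1)
      (auto intro!: choose_le_power[simplified] bexI[of _ 2] choose_less_power[simplified])
  finally show ?thesis .
qed

text \<open>The left side is \<open>fact n * fact (m + 1)\<close> times the preceding binomial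
  coefficient. The two sides appear later as the weights with which a first discrepancy between two
  solutions enters the two sides of the power series identity.\<close>

lemma fact_less_fact_sum_powers:
  assumes "2 \<le> n" "2 \<le> m"
  shows "fact (n + m) * n < fact n * fact (m + 1) * (\<Sum>k=1..n. k ^ m)"
proof -
  have "fact (m + 1) * fact (n - 1) * ((n + m) choose (m + 1)) = (fact (n + m) :: nat)"
    using binomial_fact_lemma[of "m + 1" "n + m"] assms by simp
  moreover have "fact n = n * (fact (n - 1) :: nat)" 
    using assms by (simp add: fact_reduce)
  ultimately have "fact (n + m) * n = fact n * fact (m + 1) * ((n + m) choose (m + 1))"
    by (metis mult.assoc mult.commute)
  then show ?thesis using choose_less_sum_powers[OF assms] by simp
qed

text \<open>
  Coefficients of the asymptotic expansion of \<open>t \<mapsto> E (A (c t U))\<close>, where \<open>U\<close> is standard exponential.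
\<close>
definition fps_laplace :: "'a \<Rightarrow> 'a fps \<Rightarrow> 'a::field_char_0 fps" where
  "fps_laplace c A = Abs_fps (\<lambda>j. c ^ j * fact j * fps_nth A j)"

lemma fps_laplace_nth [simp]: "fps_nth (fps_laplace c A) j = c ^ j * fact j * fps_nth A j"
  by (simp add: fps_laplace_def)

lemma fps_laplace_linear:
  "fps_laplace c (fps_const p * A + fps_const q * B)
     = fps_const p * fps_laplace c A + fps_const q * fps_laplace c B"
  by (rule fps_ext) (simp add: algebra_simps)

text \<open>Formal integration by parts in the integral of \<open>A (t u)\<close> against
  \<open>exp (- u)\<close>.\<close>

lemma fps_laplace_conv_deriv:
  "fps_laplace 1 A = fps_const (fps_nth A 0) + fps_X * fps_laplace 1 (fps_deriv A)"
proof (rule fps_ext)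
  fix j show "fps_nth (fps_laplace 1 A) j = fps_nth (fps_const (fps_nth A 0) + fps_X * fps_laplace 1 (fps_deriv A)) j"
    by (cases j) (simp_all add: algebra_simps)
qed

text \<open>For \<open>b = - a\<close> the series \<open>G\<close> is that of
  \<open>1 - exp (- a x)\<close>, the exponential distribution function. The induction works because
  \<open>q = 1 - (n + 1) b X\<close> satisfies two relations: integration by parts applied to
  \<open>G ^ (n + 1)\<close> shows that \<open>q\<close> times its transform is
  \<open>(n + 1) a X\<close> times the transform of \<open>G ^ n\<close>, and \<open>q\<close> times
  the new factor of the product is \<open>(n + 1) a X\<close> as well.\<close>

lemma fps_laplace_power_linear_ode:
  fixes G :: "'a::field_char_0 fps"
  assumes G: "fps_deriv G = fps_const b * G + fps_const a" and G0: "fps_nth G 0 = 0"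
  shows "fps_laplace 1 (G ^ n) = (\<Prod>k=1..n. fps_laplace (of_nat k) G)"
proof (induction n)
  case 0
  show ?case by (rule fps_ext) simp
next
  case (Suc n)
  let ?q = "1 - fps_const (of_nat (Suc n) * b) * fps_X"
  let ?c = "fps_const (of_nat (Suc n) * a) :: 'a fps"
  have "fps_deriv (G ^ Suc n) = of_nat (Suc n) * (fps_const b * G + fps_const a) * G ^ n"
    using fps_deriv_power[of G "Suc n"] G fps_of_nat[of "Suc n", where ?'a = 'a] by (simp del: of_nat_Suc)
  also have "\<dots> = fps_const (of_nat (Suc n) * b) * G ^ Suc n + ?c * G ^ n"
    by (simp only: fps_const_mult[symmetric] fps_of_nat) (simp add: algebra_simps)
  finally have "fps_laplace 1 (G ^ Suc n)
      = fps_X * (fps_const (of_nat (Suc n) * b) * fps_laplace 1 (G ^ Suc n) + ?c * fps_laplace 1 (G ^ n))"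
    using G0 by (subst fps_laplace_conv_deriv) (simp only: fps_laplace_linear, simp)
  then have *: "?q * fps_laplace 1 (G ^ Suc n) = ?c * fps_X * fps_laplace 1 (G ^ n)"
    by (simp add: algebra_simps)
  have G_nth: "of_nat (Suc j) * fps_nth G (Suc j) = b * fps_nth G j + (if j = 0 then a else 0)" for j
    using arg_cong[OF G, of "\<lambda>A. fps_nth A j"] by (simp add: algebra_simps)
  have **: "?q * fps_laplace (of_nat (Suc n)) G = ?c * fps_X"
  proof (rule fps_ext)
    fix j
    show "fps_nth (?q * fps_laplace (of_nat (Suc n)) G) j = fps_nth (?c * fps_X) j"
    proof (cases j)
      case 0
      then show ?thesis using G0 by simp
    next
      case (Suc i)
      \<comment> \<open>The factor \<open>Suc i\<close> contained in \<open>fact (Suc i)\<close>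
        produces the left side of \<open>G_nth\<close>; what is left after cancellation is supported
        at \<open>i = 0\<close>.\<close>
      have "fps_nth (?q * fps_laplace (of_nat (Suc n)) G) j
         = of_nat (Suc n) ^ Suc i * fact i * (of_nat (Suc i) * fps_nth G (Suc i))
           - of_nat (Suc n) * b * (of_nat (Suc n) ^ i * fact i * fps_nth G i)"
        by (simp add: Suc left_diff_distrib mult.assoc)
      also have "\<dots> = of_nat (Suc n) ^ Suc i * fact i * (if i = 0 then a else 0)"
        unfolding G_nth by (simp add: algebra_simps)
      finally show ?thesis by (simp add: Suc)
    qed
  qed
  have "?q * fps_laplace 1 (G ^ Suc n) = ?q * (fps_laplace (of_nat (Suc n)) G * fps_laplace 1 (G ^ n))"
    by (metis * ** mult.assoc)
  \<comment> \<open>The constant coefficient of \<open>?q\<close> is 1, so \<open>?q\<close> may be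
    cancelled.\<close>
  moreover have "?q \<noteq> 0"
    using arg_cong[of ?q 0 "\<lambda>A. fps_nth A 0"] by auto
  ultimately show ?case using Suc by (simp add: mult.commute)
qed

section \<open>First-order perturbation of products of power series\<close>

text \<open>A product rule: in the first degree where factors may differ, a discrepancy in one
  factor meets only the constant coefficients of the others. Dividing by
  \<open>fps_nth (\<beta> k) 0\<close> expresses the product over the other indices.\<close>

lemma fps_prod_nth_diff:
  fixes \<alpha> \<beta> :: "'i \<Rightarrow> 'a::field fps"
  assumes "finite I" and "m \<ge> 1"
    and "\<And>k j. k \<in> I \<Longrightarrow> j < m \<Longrightarrow> fps_nth (\<alpha> k) j = fps_nth (\<beta> k) j"
    and "\<And>k. k \<in> I \<Longrightarrow> fps_nth (\<beta> k) 0 \<noteq> 0"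
  shows "(\<forall>j<m. fps_nth (prod \<alpha> I) j = fps_nth (prod \<beta> I) j) \<and>
    fps_nth (prod \<alpha> I) m - fps_nth (prod \<beta> I) m
      = (\<Prod>k\<in>I. fps_nth (\<beta> k) 0) * (\<Sum>k\<in>I. (fps_nth (\<alpha> k) m - fps_nth (\<beta> k) m) / fps_nth (\<beta> k) 0)"
  using assms(1,3,4)
proof (induction rule: finite_induct)
  case (insert x I)
  let ?A = "prod \<alpha> I" and ?B = "prod \<beta> I"
  have low: "fps_nth ?A j = fps_nth ?B j" if "j < m" for j
    using insert that by auto
  have eq0: "fps_nth (\<alpha> x) 0 = fps_nth (\<beta> x) 0" using insert.prems(1)[of x 0] \<open>m \<ge> 1\<close> by simp
  have B0: "fps_nth ?B 0 = (\<Prod>k\<in>I. fps_nth (\<beta> k) 0)"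
    using insert.hyps(1) by (induction rule: finite_induct) auto
  have less: "fps_nth (\<alpha> x * ?A) j = fps_nth (\<beta> x * ?B) j" if "j < m" for j
    using that low insert.prems(1) unfolding fps_mult_nth by (intro sum.cong) auto
  \<comment> \<open>The two extreme terms of the Cauchy product are the only ones that involve a
    coefficient of degree \<open>m\<close>; the middle sum is the same for both products.\<close>
  have split: "fps_nth (U * V) m = fps_nth U 0 * fps_nth V m + fps_nth U m * fps_nth V 0
      + (\<Sum>i\<in>{1..<m}. fps_nth U i * fps_nth V (m - i))" for U V :: "'a fps"
  proof -
    have "{0..m} = insert 0 (insert m {1..<m})" using \<open>m \<ge> 1\<close> by auto
    then show ?thesis unfolding fps_mult_nth using \<open>m \<ge> 1\<close> by simp
  qed
  have mid: "(\<Sum>i\<in>{1..<m}. fps_nth (\<alpha> x) i * fps_nth ?A (m - i)) = (\<Sum>i\<in>{1..<m}. fps_nth (\<beta> x) i * fps_nth ?B (m - i))"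
    using low insert.prems(1) by (intro sum.cong) auto
  have "fps_nth (\<alpha> x * ?A) m - fps_nth (\<beta> x * ?B) m
      = fps_nth (\<beta> x) 0 * (fps_nth ?A m - fps_nth ?B m) + (fps_nth (\<alpha> x) m - fps_nth (\<beta> x) m) * fps_nth ?B 0"
    unfolding split mid using eq0 low[of 0] \<open>m \<ge> 1\<close> by (simp add: algebra_simps)
  moreover have "fps_nth (\<beta> x) 0 \<noteq> 0" using insert.prems(2)[of x] by simp
  moreover have "fps_nth ?A m - fps_nth ?B m = (\<Prod>k\<in>I. fps_nth (\<beta> k) 0) * (\<Sum>k\<in>I. (fps_nth (\<alpha> k) m - fps_nth (\<beta> k) m) / fps_nth (\<beta> k) 0)"
    using insert by auto
  ultimately have "fps_nth (\<alpha> x * ?A) m - fps_nth (\<beta> x * ?B) m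
      = fps_nth (\<beta> x) 0 * (\<Prod>k\<in>I. fps_nth (\<beta> k) 0) * ((fps_nth (\<alpha> x) m - fps_nth (\<beta> x) m) / fps_nth (\<beta> x) 0
          + (\<Sum>k\<in>I. (fps_nth (\<alpha> k) m - fps_nth (\<beta> k) m) / fps_nth (\<beta> k) 0))"
    unfolding B0 by (simp add: distrib_left)
  then show ?case using insert.hyps less by simp
qed simp

text \<open>Each factor is divisible by \<open>fps_X\<close>. Extracting these powers lowers the
  degree of the product by \<open>card I\<close> and that of each factor by 1, which reduces the
  claim to the preceding lemma.\<close>

lemma fps_prod_nth_diff_shifted:
  fixes \<alpha> \<beta> :: "'i \<Rightarrow> 'a::field fps"
  assumes "finite I" and "m \<ge> 1"
    and eq: "\<And>k j. k \<in> I \<Longrightarrow> j \<le> m \<Longrightarrow> fps_nth (\<alpha> k) j = fps_nth (\<beta> k) j"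
    and 0: "\<And>k. k \<in> I \<Longrightarrow> fps_nth (\<beta> k) 0 = 0"
    and 1: "\<And>k. k \<in> I \<Longrightarrow> fps_nth (\<beta> k) 1 \<noteq> 0"
  shows "fps_nth (prod \<alpha> I) (card I + m) - fps_nth (prod \<beta> I) (card I + m)
      = (\<Prod>k\<in>I. fps_nth (\<beta> k) 1) * (\<Sum>k\<in>I. (fps_nth (\<alpha> k) (m + 1) - fps_nth (\<beta> k) (m + 1)) / fps_nth (\<beta> k) 1)"
proof -
  have X: "fps_nth (prod \<gamma> I) (card I + m) = fps_nth (\<Prod>k\<in>I. fps_shift 1 (\<gamma> k)) m"
    if "\<And>k. k \<in> I \<Longrightarrow> fps_nth (\<gamma> k) 0 = 0" for \<gamma> :: "'i \<Rightarrow> 'a fps"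
  proof -
    have "\<gamma> k = fps_X * fps_shift 1 (\<gamma> k)" if "k \<in> I" for k
      by (rule fps_ext) (use \<open>\<And>k. k \<in> I \<Longrightarrow> fps_nth (\<gamma> k) 0 = 0\<close> that in \<open>auto simp: fps_X_mult_nth\<close>)
    then have "prod \<gamma> I = (\<Prod>k\<in>I. fps_X * fps_shift 1 (\<gamma> k))"
      by (intro prod.cong) auto
    also have "\<dots> = fps_X ^ card I * (\<Prod>k\<in>I. fps_shift 1 (\<gamma> k))"
      by (simp add: prod.distrib)
    finally show ?thesis by (simp add: fps_X_power_mult_nth)
  qed
  have "fps_nth (\<alpha> k) 0 = 0" if "k \<in> I" for k using eq[of k 0] 0 that by simp
  then show ?thesis
    using fps_prod_nth_diff[of I m "\<lambda>k. fps_shift 1 (\<alpha> k)" "\<lambda>k. fps_shift 1 (\<beta> k)"] assms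
    by (simp add: X)
qed

text \<open>Uniqueness by comparison with the explicit solution \<open>G\<close> that shares the
  coefficients of \<open>F\<close> up to degree 2. A first discrepancy \<open>d\<close> enters both
  sides of the identity linearly but with different weights, so it must vanish.\<close>

lemma fps_laplace_power_eq_prod_imp:
  fixes F :: "'a::field_char_0 fps"
  assumes F0: "fps_nth F 0 = 0" and a: "fps_nth F 1 \<noteq> 0" and n: "n \<ge> 2"
    and F: "fps_laplace 1 (F ^ n) = (\<Prod>k=1..n. fps_laplace (of_nat k) F)"
  shows "fps_deriv F = fps_const (fps_nth F 1) * fps_exp (2 * fps_nth F 2 / fps_nth F 1)"
proof -
  define a b where "a = fps_nth F 1" and "b = 2 * fps_nth F 2 / fps_nth F 1"
  \<comment> \<open>\<open>G\<close> is the antiderivative of \<open>a * exp (b x)\<close> without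
    constant term; \<open>b\<close> is chosen so that its quadratic coefficient
    \<open>a * b / 2\<close> is that of \<open>F\<close>.\<close>
  define G where "G = Abs_fps (\<lambda>j. if j = 0 then 0 else a * b ^ (j - 1) / fact j)"
  have "a \<noteq> 0" using assms by (simp add: a_def)
  have G0: "fps_nth G 0 = 0" and G1: "fps_nth G 1 = a" and G2: "fps_nth G 2 = fps_nth F 2"
    using \<open>a \<noteq> 0\<close> by (simp_all add: G_def a_def b_def)
  have G'_exp: "fps_deriv G = fps_const a * fps_exp b"
    by (rule fps_ext) (simp add: G_def field_simps del: of_nat_Suc)
  have G'_ode: "fps_deriv G = fps_const b * G + fps_const a"
  proof (rule fps_ext)
    fix j show "fps_nth (fps_deriv G) j = fps_nth (fps_const b * G + fps_const a) j"
      unfolding G'_exp by (cases j) (simp_all add: G_def mult_ac del: fact_Suc)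
  qed
  have "F = G"
  proof (rule ccontr)
    assume "F \<noteq> G"
    then have "\<exists>j. fps_nth F j \<noteq> fps_nth G j" by (auto simp: fps_eq_iff)
    then obtain l where neq: "fps_nth F l \<noteq> fps_nth G l" and less: "\<forall>j<l. fps_nth F j = fps_nth G j"
      using exists_least_iff[of "\<lambda>j. fps_nth F j \<noteq> fps_nth G j"] by blast
    have "l \<noteq> 0" "l \<noteq> 1" "l \<noteq> 2"
      using neq F0 G0 G1 G2 a_def by metis+
    then have "l \<ge> 3" by simp
    define m where "m = l - 1"
    have l: "l = m + 1" and "m \<ge> 2" using \<open>l \<ge> 3\<close> by (auto simp: m_def)
    have eq: "fps_nth F j = fps_nth G j" if "j \<le> m" for j
      using less l that by auto
    define d where "d = fps_nth F (m + 1) - fps_nth G (m + 1)"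
    have "d \<noteq> 0" using neq by (simp add: d_def l)
    \<comment> \<open>All \<open>n\<close> factors start in degree 1, so a discrepancy in degree
      \<open>m + 1\<close> of one factor is first felt in degree
      \<open>1 * (n - 1) + (m + 1) = n + m\<close>.\<close>
    have pow: "fps_nth (F ^ n) (n + m) - fps_nth (G ^ n) (n + m) = a ^ n * (of_nat n * (d / a))"
      using fps_prod_nth_diff_shifted[of "{1..n}" m "\<lambda>_. F" "\<lambda>_. G"] \<open>m \<ge> 2\<close> eq G0 G1 \<open>a \<noteq> 0\<close>
      by (simp add: d_def)
    have "fps_nth (\<Prod>k=1..n. fps_laplace (of_nat k) F) (n + m) - fps_nth (\<Prod>k=1..n. fps_laplace (of_nat k) G) (n + m)
        = (\<Prod>k=1..n. of_nat k * a) * (\<Sum>k=1..n. of_nat k ^ (m + 1) * fact (m + 1) * d / (of_nat k * a))"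
      using fps_prod_nth_diff_shifted[of "{1..n}" m "\<lambda>k. fps_laplace (of_nat k) F" "\<lambda>k. fps_laplace (of_nat k) G"]
        \<open>m \<ge> 2\<close> eq G0 G1 \<open>a \<noteq> 0\<close>
      by (simp add: d_def right_diff_distrib del: fact_Suc power_Suc)
    also have "(\<Sum>k=1..n. of_nat k ^ (m + 1) * fact (m + 1) * d / (of_nat k * a)) =
        fact (m + 1) * (d / a) * (\<Sum>k=1..n. of_nat k ^ m)"
      unfolding sum_distrib_left using \<open>a \<noteq> 0\<close> by (intro sum.cong) (auto simp: field_simps)
    also have "(\<Prod>k=1..n. of_nat k * a) = a ^ n * fact n"
      by (simp add: prod.distrib fact_prod)
    \<comment> \<open>Both \<open>F\<close> and \<open>G\<close> satisfy the identity, so each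
      product may be replaced by the transform of an \<open>n\<close>-th power, whose coefficient
      carries the factor \<open>fact (n + m)\<close>.\<close>
    finally have "fact (n + m) * (fps_nth (F ^ n) (n + m) - fps_nth (G ^ n) (n + m))
        = a ^ n * fact n * (fact (m + 1) * (d / a) * (\<Sum>k=1..n. of_nat k ^ m))"
      unfolding F[symmetric] fps_laplace_power_linear_ode[OF G'_ode G0, symmetric]
      by (simp add: right_diff_distrib)
    then have "fact (n + m) * (a ^ n * (of_nat n * (d / a)))
        = a ^ n * fact n * (fact (m + 1) * (d / a) * (\<Sum>k=1..n. of_nat k ^ m))"
      unfolding pow .
    \<comment> \<open>The common factor \<open>a ^ n * (d / a)\<close> is nonzero and cancels;
      characteristic 0 then brings the equation back to the natural numbers.\<close>
    then have "(of_nat (fact (n + m) * n) :: 'a) = of_nat (fact n * fact (m + 1) * (\<Sum>k=1..n. k ^ m))"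
      using \<open>a \<noteq> 0\<close> \<open>d \<noteq> 0\<close> by (simp add: field_simps del: fact_Suc)
    then have "fact (n + m) * n = fact n * fact (m + 1) * (\<Sum>k=1..n. k ^ m)"
      using of_nat_eq_iff by blast
    then show False using fact_less_fact_sum_powers[OF n \<open>m \<ge> 2\<close>] by simp
  qed
  then show ?thesis using G'_exp by (simp add: a_def b_def)
qed

section \<open>Asymptotic expansions\<close>

text \<open>An asymptotic expansion as \<open>t\<close> tends to 0 from the right; the series may
  diverge, as the factorials in \<open>fps_laplace\<close> suggest. Using all of
  \<open>{0<..1}\<close> gives every order a common domain, and order 0 says that
  \<open>\<psi>\<close> is bounded there.\<close>

definition asymp_fps :: "(real \<Rightarrow> complex) \<Rightarrow> complex fps \<Rightarrow> bool" where
  "asymp_fps \<psi> A \<longleftrightarrow>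
     (\<forall>M. \<exists>C. \<forall>t\<in>{0<..1}. norm (\<psi> t - (\<Sum>j<M. fps_nth A j * of_real t ^ j)) \<le> C * t ^ M)"

lemma asymp_fpsE:
  assumes "asymp_fps \<psi> A"
  obtains C where "\<And>t. t \<in> {0<..1} \<Longrightarrow> norm (\<psi> t - (\<Sum>j<M. fps_nth A j * of_real t ^ j)) \<le> C * t ^ M"
  using assms unfolding asymp_fps_def by blast

lemma asymp_fps_1: "asymp_fps (\<lambda>_. 1) 1"
  unfolding asymp_fps_def
proof
  fix M
  have "(\<Sum>j<M. fps_nth 1 j * of_real t ^ j) = (if M = 0 then 0 else 1 :: complex)" for t :: real
    by (cases M) (simp_all add: sum.lessThan_Suc_shift del: sum.lessThan_Suc)
  then show "\<exists>C. \<forall>t\<in>{0<..1}. norm (1 - (\<Sum>j<M. fps_nth 1 j * of_real t ^ j) :: complex) \<le> C * t ^ M"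
    by (intro exI[of _ 1]) auto
qed

lemma asymp_fps_mult:
  assumes \<psi>: "asymp_fps \<psi> A" and \<rho>: "asymp_fps \<rho> B"
  shows "asymp_fps (\<lambda>t. \<psi> t * \<rho> t) (A * B)"
  unfolding asymp_fps_def
proof
  fix M
  define P where "P t = (\<Sum>j<M. fps_nth A j * of_real t ^ j)" for t :: real
  define Q where "Q t = (\<Sum>j<M. fps_nth B j * of_real t ^ j)" for t :: real
  \<comment> \<open>The index pairs whose monomials occur in the product of the two truncations but
    have degree at least \<open>M\<close>; they belong to the error.\<close>
  define R where "R = {(i, j). i < M \<and> j < M \<and> \<not> i + j < M}"
  have fin: "finite R" unfolding R_def by (rule finite_subset[of _ "{..<M} \<times> {..<M}"]) auto
  obtain C0 where "\<And>t. t \<in> {0<..1} \<Longrightarrow> norm (\<psi> t - (\<Sum>j<0. fps_nth A j * of_real t ^ j)) \<le> C0 * t ^ 0"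
    using asymp_fpsE[OF \<psi>, where M = 0] by blast
  then have C0: "norm (\<psi> t) \<le> C0" if "t \<in> {0<..1}" for t
    using that by simp
  obtain C1 where C1: "\<And>t. t \<in> {0<..1} \<Longrightarrow> norm (\<psi> t - P t) \<le> C1 * t ^ M"
    unfolding P_def using asymp_fpsE[OF \<psi>, where M = M] by blast
  obtain C2 where C2: "\<And>t. t \<in> {0<..1} \<Longrightarrow> norm (\<rho> t - Q t) \<le> C2 * t ^ M"
    unfolding Q_def using asymp_fpsE[OF \<rho>, where M = M] by blast
  define CQ where "CQ = (\<Sum>j<M. norm (fps_nth B j))"
  have CQ: "norm (Q t) \<le> CQ" if "t \<in> {0<..1}" for t
    unfolding Q_def CQ_def using that
    by (intro sum_norm_le) (auto simp: norm_mult norm_power intro!: mult_left_le power_le_one)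
  define C3 where "C3 = (\<Sum>(i, j)\<in>R. norm (fps_nth A i) * norm (fps_nth B j))"
  have PQ: "P t * Q t - (\<Sum>k<M. fps_nth (A * B) k * of_real t ^ k)
      = (\<Sum>(i, j)\<in>R. fps_nth A i * fps_nth B j * of_real t ^ (i + j))" for t :: real
  proof -
    let ?g = "\<lambda>i j. fps_nth A i * fps_nth B j * of_real t ^ (i + j)"
    have "P t * Q t = (\<Sum>(i, j)\<in>{..<M} \<times> {..<M}. ?g i j)"
      unfolding P_def Q_def by (simp add: sum_product sum.cartesian_product power_add mult_ac)
    also have "{..<M} \<times> {..<M} = {(i, j). i + j < M} \<union> R" by (auto simp: R_def)
    also have "(\<Sum>(i, j)\<in>{(i, j). i + j < M} \<union> R. ?g i j) = (\<Sum>(i, j)\<in>{(i, j). i + j < M}. ?g i j) + (\<Sum>(i, j)\<in>R. ?g i j)"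
      by (intro sum.union_disjoint fin finite_subset[of "{(i, j). i + j < M}" "{..<M} \<times> {..<M}"])
        (auto simp: R_def)
    also have "(\<Sum>(i, j)\<in>{(i, j). i + j < M}. ?g i j) = (\<Sum>k<M. fps_nth (A * B) k * of_real t ^ k)"
      by (subst sum.triangle_reindex) (simp add: fps_mult_nth sum_distrib_right atMost_atLeast0)
    finally show ?thesis by simp
  qed
  have C3: "norm (P t * Q t - (\<Sum>k<M. fps_nth (A * B) k * of_real t ^ k)) \<le> C3 * t ^ M"
    if "t \<in> {0<..1}" for t
    unfolding PQ C3_def sum_distrib_right using that
    by (intro sum_norm_le) (auto simp: R_def norm_mult norm_power intro!: mult_left_mono power_decreasing)
  have "norm (\<psi> t * \<rho> t - (\<Sum>k<M. fps_nth (A * B) k * of_real t ^ k)) \<le> (C0 * C2 + C1 * CQ + C3) * t ^ M"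
    if t: "t \<in> {0<..1}" for t
  proof -
    \<comment> \<open>Three errors: the remainder of \<open>\<rho>\<close> times the bounded
      \<open>\<psi>\<close>, the remainder of \<open>\<psi>\<close> times the bounded
      \<open>Q\<close>, and the monomials indexed by \<open>R\<close>.\<close>
    have "\<psi> t * \<rho> t - (\<Sum>k<M. fps_nth (A * B) k * of_real t ^ k)
        = \<psi> t * (\<rho> t - Q t) + (\<psi> t - P t) * Q t + (P t * Q t - (\<Sum>k<M. fps_nth (A * B) k * of_real t ^ k))"
      by (simp add: algebra_simps)
    also have "norm \<dots> \<le> C0 * (C2 * t ^ M) + (C1 * t ^ M) * CQ + C3 * t ^ M"
      using C0[OF t] C1[OF t] C2[OF t] CQ[OF t] C3[OF t] norm_ge_zero order_trans
      by (intro order_trans[OF norm_triangle_ineq] add_mono)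
        (auto simp: norm_mult intro!: mult_mono intro: order_trans[OF norm_ge_zero])
    finally show ?thesis by (simp add: algebra_simps)
  qed
  then show "\<exists>C. \<forall>t\<in>{0<..1}. norm (\<psi> t * \<rho> t - (\<Sum>k<M. fps_nth (A * B) k * of_real t ^ k)) \<le> C * t ^ M"
    by blast
qed

lemma asymp_fps_prod:
  assumes "\<And>k. k \<in> I \<Longrightarrow> asymp_fps (\<psi> k) (A k)"
  shows "asymp_fps (\<lambda>t. \<Prod>k\<in>I. \<psi> k t) (\<Prod>k\<in>I. A k)"
  using assms
  by (induction I rule: infinite_finite_induct) (auto intro: asymp_fps_1 asymp_fps_mult)

text \<open>At the first index \<open>l\<close> where the series differ, subtracting the two
  expansions of order \<open>l + 1\<close> and dividing by \<open>t ^ l\<close> bounds the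
  difference of coefficients by a multiple of \<open>t\<close>, which tends to 0.\<close>

lemma asymp_fps_unique:
  assumes \<psi>A: "asymp_fps \<psi> A" and \<psi>B: "asymp_fps \<psi> B"
  shows "A = B"
proof (rule ccontr)
  assume "A \<noteq> B"
  then have "\<exists>j. fps_nth A j \<noteq> fps_nth B j" by (auto simp: fps_eq_iff)
  then obtain l where neq: "fps_nth A l \<noteq> fps_nth B l" and less: "\<forall>j<l. fps_nth A j = fps_nth B j"
    using exists_least_iff[of "\<lambda>j. fps_nth A j \<noteq> fps_nth B j"] by blast
  obtain C1 where C1: "\<And>t. t \<in> {0<..1} \<Longrightarrow> norm (\<psi> t - (\<Sum>j<Suc l. fps_nth A j * of_real t ^ j)) \<le> C1 * t ^ Suc l"
    using asymp_fpsE[OF \<psi>A, where M = "Suc l"] by blast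
  obtain C2 where C2: "\<And>t. t \<in> {0<..1} \<Longrightarrow> norm (\<psi> t - (\<Sum>j<Suc l. fps_nth B j * of_real t ^ j)) \<le> C2 * t ^ Suc l"
    using asymp_fpsE[OF \<psi>B, where M = "Suc l"] by blast
  have bound: "norm (fps_nth A l - fps_nth B l) \<le> (C1 + C2) * t" if t: "t \<in> {0<..1}" for t
  proof -
    have "(\<Sum>j<l. fps_nth A j * of_real t ^ j) = (\<Sum>j<l. fps_nth B j * of_real t ^ j)"
      using less by simp
    then have "(fps_nth A l - fps_nth B l) * of_real t ^ l
      = (\<psi> t - (\<Sum>j<Suc l. fps_nth B j * of_real t ^ j)) - (\<psi> t - (\<Sum>j<Suc l. fps_nth A j * of_real t ^ j))"
      by (simp add: algebra_simps)
    then have "norm ((fps_nth A l - fps_nth B l) * of_real t ^ l) \<le> C2 * t ^ Suc l + C1 * t ^ Suc l"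
      by (simp only: order_trans[OF norm_triangle_ineq4 add_mono[OF C2[OF t] C1[OF t]]])
    then have "norm (fps_nth A l - fps_nth B l) * t ^ l \<le> ((C1 + C2) * t) * t ^ l"
      using t by (simp only: norm_mult norm_power norm_of_real) (simp add: algebra_simps)
    then show ?thesis using t by simp
  qed
  have "((\<lambda>t. (C1 + C2) * t) \<longlongrightarrow> (C1 + C2) * 0) (at_right 0)"
    by (intro tendsto_intros)
  moreover have "\<forall>\<^sub>F t in at_right 0. norm (fps_nth A l - fps_nth B l) \<le> (C1 + C2) * t"
    using eventually_at_right_real[of 0 1] by (auto intro: bound elim!: eventually_mono)
  ultimately have "norm (fps_nth A l - fps_nth B l) \<le> (C1 + C2) * 0"
    by (rule tendsto_lowerbound) simp
  then show False using neq by simp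
qed

text \<open>The tail of the series is \<open>z ^ M\<close> times a series that is dominated by its
  absolute values at a fixed radius \<open>R\<close> inside the disc of convergence.\<close>

lemma has_fps_expansion_remainder:
  fixes A :: "complex fps"
  assumes "H has_fps_expansion A"
  obtains C r where "r > 0"
    "\<And>z. norm z < r \<Longrightarrow> norm (H z - (\<Sum>j<M. fps_nth A j * z ^ j)) \<le> C * norm z ^ M"
proof -
  obtain d where "d > 0" and d: "\<And>z. norm z < d \<Longrightarrow> eval_fps A z = H z"
    using assms unfolding has_fps_expansion_def eventually_nhds_metric by (auto simp: dist_norm)
  obtain R where "R > 0" and R: "ereal R < fps_conv_radius A"
    using assms ereal_dense2[of 0 "fps_conv_radius A"] by (auto simp: has_fps_expansion_def)
  have sm: "summable (\<lambda>j. norm (fps_nth A j) * R ^ j)"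
    using abs_summable_in_conv_radius[of "complex_of_real R" "fps_nth A"] R \<open>R > 0\<close>
    by (simp add: fps_conv_radius_def norm_mult norm_power)
  then have sm': "summable (\<lambda>j. norm (fps_nth A (j + M)) * R ^ j)"
    using summable_mult2[OF summable_ignore_initial_segment[OF sm, of M], of "inverse (R ^ M)"] \<open>R > 0\<close>
    by (simp add: power_add field_simps)
  define C where "C = (\<Sum>j. norm (fps_nth A (j + M)) * R ^ j)"
  \<comment> \<open>Within \<open>d\<close> the series represents \<open>H\<close>, and within
    \<open>R\<close> its tail is dominated.\<close>
  show thesis
  proof (rule that[of "min d R" C])
    fix z :: complex assume z: "norm z < min d R"
    have zR: "ereal (norm z) < fps_conv_radius A"
      using z R by (metis ereal_less_le less_ereal.simps(1) min_less_iff_conj order_less_imp_le)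
    have "(\<lambda>j. fps_nth A j * z ^ j) sums eval_fps A z"
      using sums_eval_fps[OF zR] .
    then have "(\<lambda>j. fps_nth A (j + M) * z ^ (j + M)) sums (H z - (\<Sum>j<M. fps_nth A j * z ^ j))"
      using d[of z] z by (subst sums_iff_shift) simp
    moreover have le: "norm (fps_nth A (j + M) * z ^ (j + M)) \<le> norm z ^ M * (norm (fps_nth A (j + M)) * R ^ j)" for j
    proof -
      have "norm z ^ j \<le> R ^ j" using z by (intro power_mono) auto
      then have "norm (fps_nth A (j + M)) * norm z ^ M * norm z ^ j \<le> norm (fps_nth A (j + M)) * norm z ^ M * R ^ j"
        by (intro mult_left_mono) auto
      then show ?thesis by (simp add: norm_mult norm_power power_add mult_ac)
    qed
    have "norm (\<Sum>j. fps_nth A (j + M) * z ^ (j + M)) \<le> (\<Sum>j. norm z ^ M * (norm (fps_nth A (j + M)) * R ^ j))"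
      by (rule norm_suminf_le) (auto intro!: le summable_mult sm')
    ultimately show "norm (H z - (\<Sum>j<M. fps_nth A j * z ^ j)) \<le> C * norm z ^ M"
      using sm' by (simp add: sums_iff C_def suminf_mult mult.commute)
  qed (use \<open>d > 0\<close> \<open>R > 0\<close> in auto)
qed

section \<open>Laplace transforms and distribution functions\<close>

abbreviation std_exponential :: "real measure" where
  "std_exponential \<equiv> density lborel (exponential_density 1)"

lemma prob_space_std_exponential: "prob_space std_exponential"
  by (rule prob_space_exponential_density) simp

lemma distributed_std_exponential: "distributed std_exponential lborel (\<lambda>x. x) (exponential_density 1)"
  by (auto simp: distributed_def distr_id2 intro!: measurable_ident_sets)

lemma has_bochner_integral_power_std_exponential:
  "has_bochner_integral std_exponential (\<lambda>u. u ^ j) (fact j)"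
  \<comment> \<open>The standard exponential law is the Erlang law with shape index 0 and rate
    1.\<close>
  using prob_space.has_bochner_integral_erlang_ith_moment[OF prob_space_std_exponential _ distributed_std_exponential]
  by simp

lemma AE_std_exponential_nonneg: "AE u in std_exponential. 0 \<le> u"
  by (simp add: AE_density exponential_density_def)

text \<open>Watson's lemma.\<close>
lemma asymp_fps_laplace:
  fixes \<phi> :: "real \<Rightarrow> complex"
  assumes \<phi>[measurable]: "\<phi> \<in> borel_measurable borel" and B: "\<And>x. norm (\<phi> x) \<le> B"
    and H: "H has_fps_expansion A" and "\<delta> > 0"
    and eq: "\<And>x. 0 \<le> x \<Longrightarrow> x < \<delta> \<Longrightarrow> \<phi> x = H (of_real x)" and "c > 0"
  shows "asymp_fps (\<lambda>t. \<integral>u. \<phi> (c * t * u) \<partial>std_exponential) (fps_laplace (of_real c) A)"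
  unfolding asymp_fps_def
proof
  fix M
  interpret E: prob_space std_exponential by (rule prob_space_std_exponential)
  define P where "P x = (\<Sum>j<M. fps_nth A j * of_real x ^ j)" for x :: real
  obtain C1 r where "r > 0"
    and C1: "\<And>z. norm z < r \<Longrightarrow> norm (H z - (\<Sum>j<M. fps_nth A j * z ^ j)) \<le> C1 * norm z ^ M"
    using has_fps_expansion_remainder[OF H, where M = M] by blast
  define s where "s = min r \<delta>"
  have "s > 0" using \<open>r > 0\<close> \<open>\<delta> > 0\<close> by (simp add: s_def)
  \<comment> \<open>Beyond \<open>s\<close> no expansion is available, but there
    \<open>1 \<le> (x / s) ^ M\<close> and \<open>x ^ j \<le> x ^ M / s ^ (M - j)\<close>, so the
    bounded \<open>\<phi>\<close> and the polynomial \<open>P\<close> are each controlled by a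
    multiple of \<open>x ^ M\<close>.\<close>
  define C2 where "C2 = B / s ^ M + (\<Sum>j<M. norm (fps_nth A j) / s ^ (M - j))"
  define C where "C = max C1 C2"
  \<comment> \<open>The bound is needed on the whole half-line because \<open>c * t * u\<close> is
    unbounded for every \<open>t\<close>. Integrating it produces the moment
    \<open>fact M\<close>.\<close>
  have C: "norm (\<phi> x - P x) \<le> C * x ^ M" if "x \<ge> 0" for x
  proof (cases "x < s")
    case True
    then have "norm (\<phi> x - P x) \<le> C1 * x ^ M"
      using C1[of "of_real x"] eq[of x] that by (simp add: s_def P_def)
    also have "\<dots> \<le> C * x ^ M" using that by (intro mult_right_mono) (auto simp: C_def)
    finally show ?thesis .
  next
    case False
    have le: "s ^ k \<le> x ^ k" for k using False \<open>s > 0\<close> by (intro power_mono) auto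
    have "norm (\<phi> x - P x) \<le> B + (\<Sum>j<M. norm (fps_nth A j) * x ^ j)"
      unfolding P_def using B[of x] that
      by (intro order_trans[OF norm_triangle_ineq4] add_mono sum_norm_le) (auto simp: norm_mult norm_power)
    also have "\<dots> \<le> B / s ^ M * x ^ M + (\<Sum>j<M. norm (fps_nth A j) / s ^ (M - j) * x ^ M)"
    proof (intro add_mono sum_mono)
      have "B \<ge> 0" using order_trans[OF norm_ge_zero B] .
      then show "B \<le> B / s ^ M * x ^ M"
        using le[of M] \<open>s > 0\<close> by (simp add: field_simps mult_left_mono)
      fix j assume "j \<in> {..<M}"
      then have xM: "x ^ M = x ^ j * x ^ (M - j)" by (simp flip: power_add)
      have "x ^ j * s ^ (M - j) \<le> x ^ M"
        unfolding xM using le[of "M - j"] that by (intro mult_left_mono) auto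
      then have "norm (fps_nth A j) * (x ^ j * s ^ (M - j)) \<le> norm (fps_nth A j) * x ^ M"
        by (rule mult_left_mono) simp
      then show "norm (fps_nth A j) * x ^ j \<le> norm (fps_nth A j) / s ^ (M - j) * x ^ M"
        using \<open>s > 0\<close> by (simp add: field_simps)
    qed
    also have "\<dots> = C2 * x ^ M" by (simp add: C2_def distrib_right sum_distrib_right)
    also have "\<dots> \<le> C * x ^ M" using that by (intro mult_right_mono) (auto simp: C_def)
    finally show ?thesis .
  qed
  have "norm ((\<integral>u. \<phi> (c * t * u) \<partial>std_exponential) - (\<Sum>j<M. fps_nth (fps_laplace (of_real c) A) j * of_real t ^ j))
      \<le> (C * c ^ M * fact M) * t ^ M" if t: "t \<in> {0<..1}" for t
  proof -
    have int\<phi>: "integrable std_exponential (\<lambda>u. \<phi> (c * t * u))"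
      by (rule E.integrable_const_bound[of _ B]) (auto simp: B)
    have "has_bochner_integral std_exponential (\<lambda>u. fps_nth A j * of_real (c * t) ^ j * of_real (u ^ j))
        (fps_nth A j * of_real (c * t) ^ j * of_real (fact j))" for j
      by (intro has_bochner_integral_mult_right has_bochner_integral_of_real has_bochner_integral_power_std_exponential)
    then have "has_bochner_integral std_exponential (\<lambda>u. \<Sum>j<M. fps_nth A j * of_real (c * t) ^ j * of_real (u ^ j))
        (\<Sum>j<M. fps_nth A j * of_real (c * t) ^ j * of_real (fact j))"
      by (intro has_bochner_integral_sum)
    moreover have "(\<Sum>j<M. fps_nth A j * of_real (c * t) ^ j * of_real (u ^ j)) = P (c * t * u)" for u
      by (simp add: P_def power_mult_distrib mult_ac)
    moreover have "(\<Sum>j<M. fps_nth A j * of_real (c * t) ^ j * of_real (fact j))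
        = (\<Sum>j<M. fps_nth (fps_laplace (of_real c) A) j * of_real t ^ j)"
      by (simp add: power_mult_distrib mult_ac)
    ultimately have P: "has_bochner_integral std_exponential (\<lambda>u. P (c * t * u))
        (\<Sum>j<M. fps_nth (fps_laplace (of_real c) A) j * of_real t ^ j)" by simp
    have CM: "has_bochner_integral std_exponential (\<lambda>u. C * (c * t) ^ M * u ^ M) (C * (c * t) ^ M * fact M)"
      by (intro has_bochner_integral_mult_right has_bochner_integral_power_std_exponential)
    have "(\<integral>u. \<phi> (c * t * u) \<partial>std_exponential) - (\<Sum>j<M. fps_nth (fps_laplace (of_real c) A) j * of_real t ^ j)
       = (\<integral>u. \<phi> (c * t * u) - P (c * t * u) \<partial>std_exponential)"
      using P int\<phi> by (simp add: has_bochner_integral_iff)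
    also have "norm \<dots> \<le> (\<integral>u. C * (c * t) ^ M * u ^ M \<partial>std_exponential)"
    proof (rule order_trans[OF integral_norm_bound integral_mono_AE])
      show "integrable std_exponential (\<lambda>u. norm (\<phi> (c * t * u) - P (c * t * u)))"
        using P int\<phi> by (auto simp: has_bochner_integral_iff)
      show "integrable std_exponential (\<lambda>u. C * (c * t) ^ M * u ^ M)"
        using CM by (simp add: has_bochner_integral_iff)
      show "AE u in std_exponential. norm (\<phi> (c * t * u) - P (c * t * u)) \<le> C * (c * t) ^ M * u ^ M"
        using AE_std_exponential_nonneg
      proof eventually_elim
        case (elim u)
        then show ?case using C[of "c * t * u"] t \<open>c > 0\<close> by (simp add: power_mult_distrib mult_ac)
      qed
    qed
    also have "\<dots> = (C * c ^ M * fact M) * t ^ M"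
      using CM by (simp add: has_bochner_integral_iff power_mult_distrib mult_ac)
    finally show ?thesis .
  qed
  then show "\<exists>K. \<forall>t\<in>{0<..1}. norm ((\<integral>u. \<phi> (c * t * u) \<partial>std_exponential)
      - (\<Sum>j<M. fps_nth (fps_laplace (of_real c) A) j * of_real t ^ j)) \<le> K * t ^ M"
    by blast
qed

section \<open>Laplace transforms of independent sums and maxima\<close>

lemma emeasure_std_exponential_Ici:
  assumes "0 \<le> a"
  shows "emeasure std_exponential {a..} = ennreal (exp (- a))"
proof -
  interpret E: prob_space std_exponential by (rule prob_space_std_exponential)
  have "emeasure std_exponential {a..} = emeasure std_exponential {a<..}"
  proof (rule emeasure_eq_AE)
    have "AE x in lborel. x \<noteq> a" by (rule AE_lborel_singleton)
    then show "AE x in std_exponential. x \<in> {a..} \<longleftrightarrow> x \<in> {a<..}"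
      by (auto simp: AE_density elim!: eventually_mono)
  qed auto
  also have "\<dots> = ennreal (exp (- a))"
    using E.exponential_distributedD_gt[OF distributed_std_exponential assms]
    by (simp add: E.emeasure_eq_measure greaterThan_def)
  finally show ?thesis .
qed

text \<open>For \<open>y \<ge> 0\<close> the number \<open>exp (- y / t)\<close> is the probability
  that a standard exponential \<open>U\<close> satisfies \<open>y \<le> t U\<close>. Both sides are
  therefore the probability of this event for independent \<open>y\<close> and \<open>U\<close>,
  evaluated in the two orders of integration.\<close>

lemma (in real_distribution) nn_integral_exp_eq_nn_integral_cdf:
  assumes nonneg: "AE y in M. 0 \<le> y" and "t > 0"
  shows "(\<integral>\<^sup>+y. ennreal (exp (- y / t)) \<partial>M) = (\<integral>\<^sup>+u. ennreal (cdf M (t * u)) \<partial>std_exponential)"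
proof -
  interpret E: prob_space std_exponential by (rule prob_space_std_exponential)
  interpret pair_sigma_finite M std_exponential ..
  have [measurable]: "Measurable.pred (M \<Otimes>\<^sub>M std_exponential) (\<lambda>(y, u). y \<le> t * u)"
    by measurable
  have "(\<integral>\<^sup>+y. ennreal (exp (- y / t)) \<partial>M) = (\<integral>\<^sup>+y. (\<integral>\<^sup>+u. indicator {(y, u). y \<le> t * u} (y, u) \<partial>std_exponential) \<partial>M)"
  proof (rule nn_integral_cong_AE)
    show "AE y in M. ennreal (exp (- y / t)) = (\<integral>\<^sup>+u. indicator {(y, u). y \<le> t * u} (y, u) \<partial>std_exponential)"
      using nonneg
    proof eventually_elim
      case (elim y)
      have "(\<integral>\<^sup>+u. indicator {(y, u). y \<le> t * u} (y, u) \<partial>std_exponential)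
          = (\<integral>\<^sup>+u. indicator {y / t..} u \<partial>std_exponential)"
        using \<open>t > 0\<close> by (intro nn_integral_cong) (auto simp: indicator_def field_simps)
      also have "\<dots> = ennreal (exp (- y / t))"
        using elim \<open>t > 0\<close> by (simp add: emeasure_std_exponential_Ici)
      finally show ?case by simp
    qed
  qed
  also have "\<dots> = (\<integral>\<^sup>+u. (\<integral>\<^sup>+y. indicator {(y, u). y \<le> t * u} (y, u) \<partial>M) \<partial>std_exponential)"
    by (intro Fubini'[symmetric]) (simp add: split_beta')
  also have "\<dots> = (\<integral>\<^sup>+u. ennreal (cdf M (t * u)) \<partial>std_exponential)"
  proof (rule nn_integral_cong)
    fix u
    have "(\<integral>\<^sup>+y. indicator {(y, u). y \<le> t * u} (y, u) \<partial>M) = (\<integral>\<^sup>+y. indicator {..t * u} y \<partial>M)"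
      by (intro nn_integral_cong) (auto simp: indicator_def)
    then show "(\<integral>\<^sup>+y. indicator {(y, u). y \<le> t * u} (y, u) \<partial>M) = ennreal (cdf M (t * u))"
      by (simp add: cdf_def emeasure_eq_measure)
  qed
  finally show ?thesis .
qed

lemma (in real_distribution) integral_cdf_std_exponential:
  "(\<integral>\<^sup>+u. ennreal (cdf M (t * u) ^ n) \<partial>std_exponential)
    = ennreal (\<integral>u. cdf M (t * u) ^ n \<partial>std_exponential)"
proof (rule nn_integral_eq_integral)
  interpret E: prob_space std_exponential by (rule prob_space_std_exponential)
  have [measurable]: "cdf M \<in> borel_measurable borel"
    by (intro borel_measurable_mono monoI cdf_nondecreasing)
  show "integrable std_exponential (\<lambda>u. cdf M (t * u) ^ n)"
    by (rule E.integrable_const_bound[of _ 1])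
      (auto simp: cdf_nonneg cdf_bounded_prob power_le_one)
qed (simp add: cdf_nonneg)

lemma (in prob_space) cdf_Max_indep_vars:
  fixes Xs :: "'i \<Rightarrow> 'a \<Rightarrow> real"
  assumes indep: "indep_vars (\<lambda>_. borel) Xs I" and I: "finite I" "I \<noteq> {}"
    and D: "\<And>i. i \<in> I \<Longrightarrow> distr M borel (Xs i) = D"
  shows "cdf (distr M borel (\<lambda>\<omega>. MAX i\<in>I. Xs i \<omega>)) x = cdf D x ^ card I"
proof -
  have meas: "i \<in> I \<Longrightarrow> Xs i \<in> borel_measurable M" for i
    using indep by (auto simp: indep_vars_def)
  have Max_le: "(MAX i\<in>I. Xs i \<omega>) \<le> x \<longleftrightarrow> (\<forall>i\<in>I. Xs i \<omega> \<le> x)" for \<omega>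
    using I by (subst Max_le_iff) auto
  have "(\<lambda>\<omega>. MAX i\<in>I. Xs i \<omega>) \<in> borel_measurable M"
    using I meas by (intro borel_measurable_Max) auto
  then have "cdf (distr M borel (\<lambda>\<omega>. MAX i\<in>I. Xs i \<omega>)) x = prob ((\<lambda>\<omega>. MAX i\<in>I. Xs i \<omega>) -` {..x} \<inter> space M)"
    by (simp add: cdf_def measure_distr)
  also have "(\<lambda>\<omega>. MAX i\<in>I. Xs i \<omega>) -` {..x} \<inter> space M = (\<Inter>i\<in>I. Xs i -` {..x} \<inter> space M)"
    using I(2) by (auto simp: Max_le)
  also have "prob \<dots> = (\<Prod>i\<in>I. prob (Xs i -` {..x} \<inter> space M))"
    using indep I by (intro indep_varsD_finite) auto
  also have "\<dots> = (\<Prod>i\<in>I. cdf D x)"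
  proof (rule prod.cong)
    fix i assume "i \<in> I"
    then show "prob (Xs i -` {..x} \<inter> space M) = cdf D x"
      unfolding D[OF \<open>i \<in> I\<close>, symmetric] cdf_def by (subst measure_distr) (auto intro: meas)
  qed simp
  finally show ?thesis by simp
qed

text \<open>Both sides are the Laplace transform at \<open>1 / t\<close> of the common law of the
  weighted sum and the maximum. The sum factorises by independence, its weight \<open>1 / k\<close>
  replacing \<open>t\<close> by \<open>k * t\<close>; the maximum has distribution function
  \<open>F ^ n\<close>.\<close>

lemma (in prob_space) prod_integral_cdf_eq:
  fixes Xs :: "nat \<Rightarrow> 'a \<Rightarrow> real"
  assumes indep: "indep_vars (\<lambda>_. borel) Xs {1..n}" and "n \<ge> 1"
    and D: "\<And>i. i \<in> {1..n} \<Longrightarrow> distr M borel (Xs i) = D" and nonneg: "AE y in D. 0 \<le> y"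
    and eq: "distr M borel (\<lambda>\<omega>. \<Sum>i=1..n. 1 / real i * Xs i \<omega>) = distr M borel (\<lambda>\<omega>. MAX i\<in>{1..n}. Xs i \<omega>)"
    and "t > 0"
  shows "(\<Prod>k=1..n. \<integral>u. cdf D (real k * t * u) \<partial>std_exponential)
      = (\<integral>u. cdf D (t * u) ^ n \<partial>std_exponential)"
proof -
  have meas[measurable]: "i \<in> {1..n} \<Longrightarrow> Xs i \<in> borel_measurable M" for i
    using indep by (auto simp: indep_vars_def)
  interpret D: real_distribution D
    using D[of 1] meas[of 1] \<open>n \<ge> 1\<close> by (auto simp: real_distribution_distr)
  let ?S = "\<lambda>\<omega>. \<Sum>i=1..n. 1 / real i * Xs i \<omega>" and ?m = "\<lambda>\<omega>. MAX i\<in>{1..n}. Xs i \<omega>"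
  have S[measurable]: "?S \<in> borel_measurable M" by measurable
  have m[measurable]: "?m \<in> borel_measurable M"
    using \<open>n \<ge> 1\<close> by (intro borel_measurable_Max) auto
  interpret m: real_distribution "distr M borel ?m"
    by (rule real_distribution_distr) fact
  have nonneg_X: "AE \<omega> in M. 0 \<le> Xs i \<omega>" if "i \<in> {1..n}" for i
    using nonneg unfolding D[OF that, symmetric] by (rule AE_distrD[OF meas[OF that]])
  have nonneg_m: "AE y in distr M borel ?m. 0 \<le> y"
  proof (subst AE_distr_iff[OF m])
    show "AE \<omega> in M. 0 \<le> ?m \<omega>"
      using nonneg_X[of 1] \<open>n \<ge> 1\<close> by (auto simp: Max_ge_iff elim!: eventually_mono)
  qed simp
  have "(\<integral>\<^sup>+u. ennreal (cdf D (t * u) ^ n) \<partial>std_exponential)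
      = (\<integral>\<^sup>+u. ennreal (cdf (distr M borel ?m) (t * u)) \<partial>std_exponential)"
    using cdf_Max_indep_vars[OF indep _ _ D] \<open>n \<ge> 1\<close> by simp
  also have "\<dots> = (\<integral>\<^sup>+y. ennreal (exp (- y / t)) \<partial>distr M borel ?m)"
    using m.nn_integral_exp_eq_nn_integral_cdf[OF nonneg_m \<open>t > 0\<close>] by simp
  \<comment> \<open>The assumed equality in distribution passes from the maximum to the sum
    here.\<close>
  also have "\<dots> = (\<integral>\<^sup>+\<omega>. ennreal (exp (- ?S \<omega> / t)) \<partial>M)"
    unfolding eq[symmetric] by (subst nn_integral_distr) auto
  also have "\<dots> = (\<integral>\<^sup>+\<omega>. (\<Prod>k=1..n. ennreal (exp (- Xs k \<omega> / (real k * t)))) \<partial>M)"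
  proof (rule nn_integral_cong)
    fix \<omega>
    have "- ?S \<omega> / t = (\<Sum>k=1..n. - Xs k \<omega> / (real k * t))"
      by (simp add: sum_negf sum_divide_distrib)
    then show "ennreal (exp (- ?S \<omega> / t)) = (\<Prod>k=1..n. ennreal (exp (- Xs k \<omega> / (real k * t))))"
      by (simp add: exp_sum prod_ennreal)
  qed
  also have "\<dots> = (\<Prod>k=1..n. \<integral>\<^sup>+\<omega>. ennreal (exp (- Xs k \<omega> / (real k * t))) \<partial>M)"
    by (intro indep_vars_nn_integral indep_vars_compose2[OF indep]) auto
  also have "\<dots> = (\<Prod>k=1..n. \<integral>\<^sup>+u. ennreal (cdf D (real k * t * u)) \<partial>std_exponential)"
  proof (rule prod.cong)
    fix k assume k: "k \<in> {1..n}"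
    have "(\<integral>\<^sup>+\<omega>. ennreal (exp (- Xs k \<omega> / (real k * t))) \<partial>M) = (\<integral>\<^sup>+y. ennreal (exp (- y / (real k * t))) \<partial>distr M borel (Xs k))"
      using meas[OF k] by (subst nn_integral_distr) auto
    also have "\<dots> = (\<integral>\<^sup>+u. ennreal (cdf D (real k * t * u)) \<partial>std_exponential)"
      unfolding D[OF k] using k \<open>t > 0\<close> by (intro D.nn_integral_exp_eq_nn_integral_cdf nonneg) auto
    finally show "(\<integral>\<^sup>+\<omega>. ennreal (exp (- Xs k \<omega> / (real k * t))) \<partial>M) = (\<integral>\<^sup>+u. ennreal (cdf D (real k * t * u)) \<partial>std_exponential)" .
  qed simp
  also have "\<dots> = ennreal (\<Prod>k=1..n. \<integral>u. cdf D (real k * t * u) \<partial>std_exponential)"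
    using D.integral_cdf_std_exponential[of _ 1]
    by (simp add: prod_ennreal integral_nonneg D.cdf_nonneg)
  finally have "ennreal (\<integral>u. cdf D (t * u) ^ n \<partial>std_exponential) = ennreal (\<Prod>k=1..n. \<integral>u. cdf D (real k * t * u) \<partial>std_exponential)"
    by (simp only: D.integral_cdf_std_exponential)
  then show ?thesis
    by (simp add: prod_nonneg integral_nonneg D.cdf_nonneg)
qed

section \<open>Analytic densities\<close>

text \<open>The fundamental theorem of calculus along a real segment. Since \<open>g\<close> is real
  there, the imaginary part of \<open>H\<close> is the integral of 0.\<close>

lemma has_integral_along_reals:
  assumes "\<And>s. s \<in> {0..x} \<Longrightarrow> (H has_field_derivative g (of_real s)) (at (of_real s))" and "0 \<le> x"
    and "\<And>s. s \<in> {0..x} \<Longrightarrow> g (of_real s) = complex_of_real (f s)" and "H 0 = 0"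
  shows "(f has_integral Re (H (of_real x))) {0..x}" and "Im (H (of_real x)) = 0"
proof -
  have "((\<lambda>s. g (of_real s)) has_integral (H (of_real x) - H (of_real 0))) {0..x}"
    using assms(1,2) by (intro fundamental_theorem_of_calculus has_vector_derivative_real_field) auto
  then have *: "((\<lambda>s. complex_of_real (f s)) has_integral H (of_real x)) {0..x}"
    using assms(4) by (intro has_integral_eq[OF assms(3)]) simp_all
  show "(f has_integral Re (H (of_real x))) {0..x}"
    using has_integral_linear[OF * bounded_linear_Re] by (simp add: o_def)
  have "((\<lambda>s. 0) has_integral Im (H (of_real x))) {0..x}"
    using has_integral_linear[OF * bounded_linear_Im] by (simp add: o_def)
  then show "Im (H (of_real x)) = 0"
    using has_integral_unique[OF has_integral_0] by metis
qed

text \<open>Makes the distribution function the restriction of a function differentiable in the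
  complex sense, the form in which Watson's lemma needs it.\<close>

lemma cdf_density_eq_primitive:
  fixes f :: "real \<Rightarrow> real"
  assumes f[measurable]: "f \<in> borel_measurable borel" and nonneg: "\<And>x. 0 \<le> f x" and neg: "\<And>x. x < 0 \<Longrightarrow> f x = 0"
    and H: "\<And>s. s \<in> {0..x} \<Longrightarrow> (H has_field_derivative g (of_real s)) (at (of_real s))" and "0 \<le> x"
    and g: "\<And>s. s \<in> {0..x} \<Longrightarrow> g (of_real s) = complex_of_real (f s)" and "H 0 = 0"
  shows "complex_of_real (cdf (density lborel (\<lambda>x. ennreal (f x))) x) = H (of_real x)"
proof -
  note int = has_integral_along_reals[OF H \<open>0 \<le> x\<close> g \<open>H 0 = 0\<close>]
  have "((\<lambda>s. if s \<in> {0..x} then f s else 0) has_integral Re (H (of_real x))) UNIV"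
    using int(1) by (simp only: has_integral_restrict_UNIV)
  then have I: "integral\<^sup>N lborel (\<lambda>s. if s \<in> {0..x} then f s else 0) = ennreal (Re (H (of_real x)))"
    using nonneg by (intro nn_integral_has_integral_lborel) auto
  have "emeasure (density lborel (\<lambda>x. ennreal (f x))) {..x} = (\<integral>\<^sup>+s. ennreal (f s) * indicator {..x} s \<partial>lborel)"
    by (intro emeasure_density) auto
  also have "\<dots> = integral\<^sup>N lborel (\<lambda>s. if s \<in> {0..x} then f s else 0)"
    using neg by (intro nn_integral_cong) (auto simp: indicator_def not_le)
  finally have "cdf (density lborel (\<lambda>x. ennreal (f x))) x = Re (H (of_real x))"
    using I has_integral_nonneg[OF int(1)] nonneg by (simp add: cdf_def measure_def)
  then show ?thesis using int(2) by (simp add: complex_eq_iff)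
qed

section \<open>Recognising the exponential law\<close>

lemma exponential_on_nonneg:
  fixes g :: "complex \<Rightarrow> complex"
  assumes S: "open S" "complex_of_real ` {0..} \<subseteq> S" "g holomorphic_on S"
    and g: "g has_fps_expansion fps_const a * fps_exp b" and "x \<ge> 0"
  shows "g (of_real x) = a * exp (b * of_real x)"
proof -
  \<comment> \<open>\<open>S\<close> may be disconnected; analytic continuation takes place in the
    component of 0, which contains the connected half-line.\<close>
  define T where "T = connected_component_set S 0"
  have "0 \<in> complex_of_real ` {0..}" by force
  then have T: "complex_of_real ` {0..} \<subseteq> T"
    unfolding T_def using S(2)
    by (intro connected_component_maximal connected_continuous_image continuous_intros connected_Ici) auto
  have exp: "(\<lambda>z. g z - a * exp (b * z)) has_fps_expansion 0"
    using has_fps_expansion_diff[OF g has_fps_expansion_cmult_left[OF has_fps_expansion_exp, of a b]] by simp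
  have "T \<subseteq> S" unfolding T_def by (rule connected_component_subset)
  then have hol: "(\<lambda>z. g z - a * exp (b * z)) holomorphic_on T"
    using S(3) by (intro holomorphic_intros) (auto intro: holomorphic_on_subset)
  have "open T" "connected T"
    using S(1) by (auto simp: T_def open_connected_component)
  moreover have "0 \<in> T" using T \<open>0 \<in> complex_of_real ` {0..}\<close> by (rule subsetD)
  moreover have "of_real x \<in> T" using T \<open>x \<ge> 0\<close> by (intro subsetD[OF T] imageI) simp
  ultimately have "g (of_real x) - a * exp (b * of_real x) = 0"
    by (rule has_fps_expansion_0_analytic_continuation[OF exp hol])
  then show ?thesis by simp
qed

lemma real_exponential_rate:
  fixes f :: "real \<Rightarrow> real"
  assumes f: "\<And>x. x \<ge> 0 \<Longrightarrow> complex_of_real (f x) = a * exp (b * of_real x)" and "f 0 \<noteq> 0"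
  shows "b \<in> \<real>"
proof (rule ccontr)
  assume "b \<notin> \<real>"
  then have Im: "Im b \<noteq> 0" by (simp add: complex_is_Real_iff)
  have a: "a = complex_of_real (f 0)" using f[of 0] by simp
  \<comment> \<open>At this point \<open>b * x\<close> has imaginary part \<open>pi / 2\<close> or
    \<open>- pi / 2\<close>, so \<open>exp (b * x)\<close> is a nonzero imaginary number.\<close>
  define x where "x = pi / (2 * \<bar>Im b\<bar>)"
  have "x \<ge> 0" by (simp add: x_def)
  have "Im (a * exp (b * of_real x)) = 0" using f[OF \<open>x \<ge> 0\<close>] by (metis Im_complex_of_real)
  then have "sin (Im b * x) = 0" using \<open>f 0 \<noteq> 0\<close> by (simp add: a Im_exp)
  moreover have "Im b * x = pi / 2 \<or> Im b * x = - (pi / 2)"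
    using Im by (auto simp: x_def abs_if)
  then have "sin (Im b * x) = sin (pi / 2) \<or> sin (Im b * x) = - sin (pi / 2)"
    by (elim disjE) (simp_all only: sin_minus simp_thms)
  ultimately show False by simp
qed

lemma exponential_density_eqI:
  fixes f :: "real \<Rightarrow> real"
  assumes prob: "prob_space (density lborel (\<lambda>x. ennreal (f x)))"
    and f: "\<And>x. x \<ge> 0 \<Longrightarrow> f x = a * exp (b * x)" and neg: "\<And>x. x < 0 \<Longrightarrow> f x = 0" and "a > 0"
  obtains l where "l > 0" "f = exponential_density l"
proof -
  interpret prob_space "density lborel (\<lambda>x. ennreal (f x))" by fact
  have feq: "f = (\<lambda>x. if x < 0 then 0 else a * exp (b * x))"
    using f neg by (auto simp: not_less)
  then have [measurable]: "f \<in> borel_measurable borel" by (simp only:) measurable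
  have int: "(\<integral>\<^sup>+x. ennreal (f x) \<partial>lborel) = 1"
    using emeasure_space_1 by (simp add: emeasure_density)
  have "b < 0"
  proof (rule ccontr)
    assume "\<not> b < 0"
    \<comment> \<open>If \<open>b \<ge> 0\<close> then \<open>f \<ge> a\<close> on an interval of
      length \<open>1 / a + 1\<close>, which already carries mass \<open>1 + a > 1\<close>.\<close>
    have "ennreal (a * (1 / a + 1)) = (\<integral>\<^sup>+x. ennreal a * indicator {0..1 / a + 1} x \<partial>lborel)"
      using \<open>a > 0\<close> by (simp add: nn_integral_cmult_indicator ennreal_mult)
    also have "\<dots> \<le> (\<integral>\<^sup>+x. ennreal (f x) \<partial>lborel)"
      using \<open>\<not> b < 0\<close> \<open>a > 0\<close>
      by (intro nn_integral_mono) (auto simp: indicator_def f ennreal_leI)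
    finally have "ennreal (a * (1 / a + 1)) \<le> ennreal 1" unfolding int by simp
    then have "a * (1 / a + 1) \<le> 1" by (subst (asm) ennreal_le_iff) auto
    moreover have "a * (1 / a + 1) = 1 + a" using \<open>a > 0\<close> by (simp add: field_simps)
    ultimately show False using \<open>a > 0\<close> by simp
  qed
  define l where "l = - b"
  have "l > 0" using \<open>b < 0\<close> by (simp add: l_def)
  interpret E: prob_space "density lborel (exponential_density l)"
    by (rule prob_space_exponential_density) fact
  \<comment> \<open>A multiple of a probability density that itself has integral 1 must have factor
    1.\<close>
  have f_eq: "f x = a / l * exponential_density l x" for x
    using \<open>l > 0\<close> f neg by (auto simp: exponential_density_def l_def not_less mult.commute)
  have "1 = (\<integral>\<^sup>+x. ennreal (a / l) * ennreal (exponential_density l x) \<partial>lborel)"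
    unfolding int[symmetric] f_eq using \<open>a > 0\<close> \<open>l > 0\<close>
    by (intro nn_integral_cong ennreal_mult exponential_density_nonneg) auto
  also have "\<dots> = ennreal (a / l) * (\<integral>\<^sup>+x. ennreal (exponential_density l x) \<partial>lborel)"
    by (intro nn_integral_cmult) auto
  also have "(\<integral>\<^sup>+x. ennreal (exponential_density l x) \<partial>lborel) = 1"
    using E.emeasure_space_1 by (simp add: emeasure_density)
  finally have "a / l = 1" by (metis ennreal_eq_1 mult.right_neutral)
  then show thesis using that[OF \<open>l > 0\<close>] f_eq by (simp add: fun_eq_iff)
qed

text \<open>Applied to the extension \<open>g\<close> of the density: \<open>H\<close> then extends
  the distribution function near 0, and \<open>F\<close> is the series that enters the power series
  identity.\<close>

lemma holomorphic_primitive_fps: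
  assumes g: "g holomorphic_on ball 0 r" and "r > 0"
  obtains H F where "H 0 = 0" "\<And>z. z \<in> ball 0 r \<Longrightarrow> (H has_field_derivative g z) (at z)"
    "H has_fps_expansion F" "g has_fps_expansion fps_deriv F"
proof -
  obtain H0 where H0: "\<And>z. z \<in> ball 0 r \<Longrightarrow> (H0 has_field_derivative g z) (at z within ball 0 r)"
    using holomorphic_convex_primitive'[OF convex_ball open_ball g] by blast
  define H where "H = (\<lambda>z. H0 z - H0 0)"
  have H: "(H has_field_derivative g z) (at z)" if "z \<in> ball 0 r" for z
  proof -
    have "(H0 has_field_derivative g z) (at z)"
      using H0[OF that] at_within_open[OF that open_ball] by simp
    from DERIV_diff[OF this DERIV_const] show ?thesis by (simp add: H_def)
  qed
  have "H holomorphic_on ball 0 r"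
    using H unfolding holomorphic_on_open[OF open_ball] by blast
  then have HF: "H has_fps_expansion fps_expansion H 0"
    by (rule has_fps_expansion_fps_expansion[rotated 2]) (use \<open>r > 0\<close> in auto)
  have "\<forall>\<^sub>F z in nhds 0. z \<in> ball 0 r"
    using \<open>r > 0\<close> by (intro eventually_nhds_in_open) auto
  then have "\<forall>\<^sub>F z in nhds 0. deriv H z = g z"
    by eventually_elim (rule DERIV_imp_deriv[OF H])
  then have "g has_fps_expansion fps_deriv (fps_expansion H 0)"
    using has_fps_expansion_deriv[OF HF] has_fps_expansion_cong[OF _ refl] by blast
  then show thesis using that[OF _ H HF] by (simp add: H_def)
qed

theorem mainTheorem2:
  fixes N :: "'a measure" and X :: "'a \<Rightarrow> real" and f :: "real \<Rightarrow> real"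
    and M :: "'b measure" and Xs :: "nat \<Rightarrow> 'b \<Rightarrow> real" and n :: nat
  assumes "prob_space N"
    and "AE \<omega> in N. 0 \<le> X \<omega>"
    and "distributed N lborel X (\<lambda>x. ennreal (f x))"
    and "\<And>x. 0 \<le> f x"
    and "\<And>x. x < 0 \<Longrightarrow> f x = 0"
    and "complex_analytic_on_nonneg f"
    and "0 < f 0"
    and "2 \<le> n"
    and "prob_space M"
    and "prob_space.indep_vars M (\<lambda>_. borel) Xs {1..n}"
    and "\<And>i. i \<in> {1..n} \<Longrightarrow> distr M borel (Xs i) = distr N borel X"
    and "distr M borel (\<lambda>\<omega>. \<Sum>i=1..n. 1 / real i * Xs i \<omega>)
       = distr M borel (\<lambda>\<omega>. MAX i\<in>{1..n}. Xs i \<omega>)"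
  shows "\<exists>l>0. distributed N lborel X (\<lambda>x. ennreal (exponential_density l x)) \<and>
               (\<forall>x\<ge>0. f x = l * exp (- l * x))"
proof -
  interpret N: prob_space N by fact
  interpret M: prob_space M by fact
  note XN = \<open>distributed N lborel X (\<lambda>x. ennreal (f x))\<close>
  have [measurable]: "X \<in> borel_measurable N"
    using distributed_measurable[OF XN] by simp
  \<comment> \<open>\<open>distributed\<close> only gives measurability after the embedding into
    \<open>ennreal\<close>; nonnegativity of \<open>f\<close> allows it to be undone.\<close>
  have "(\<lambda>x. enn2real (ennreal (f x))) \<in> borel_measurable borel"
    using distributed_borel_measurable[OF XN] by simp
  then have f_meas: "f \<in> borel_measurable borel"
    using \<open>\<And>x. 0 \<le> f x\<close> by simp
  define D where "D = density lborel (\<lambda>x. ennreal (f x))"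
  have D_X: "distr N borel X = D"
    using distributed_distr_eq_density[OF XN] by (simp add: D_def cong: distr_cong)
  interpret D: real_distribution D
    unfolding D_X[symmetric] by (rule N.real_distribution_distr) simp
  have nonneg_D: "AE y in D. 0 \<le> y"
    unfolding D_X[symmetric] using \<open>AE \<omega> in N. 0 \<le> X \<omega>\<close> by (subst AE_distr_iff) auto
  have cdf_D[measurable]: "cdf D \<in> borel_measurable borel"
    by (intro borel_measurable_mono monoI D.cdf_nondecreasing)

  obtain g S where S: "open S" "complex_of_real ` {0..} \<subseteq> S" "g analytic_on S"
    and g: "\<And>x. x \<ge> 0 \<Longrightarrow> g (complex_of_real x) = complex_of_real (f x)"
    using \<open>complex_analytic_on_nonneg f\<close> unfolding complex_analytic_on_nonneg_def by blast
  have "complex_of_real 0 \<in> S" using S(2) by (rule subsetD) simp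
  then obtain r where "r > 0" and r: "ball 0 r \<subseteq> S"
    using S(1) openE by auto
  have g_hol: "g holomorphic_on ball 0 r" and g_S: "g holomorphic_on S"
    using S(3) r analytic_imp_holomorphic analytic_on_subset by blast+
  obtain H F where H0_0: "H 0 = 0" and H: "\<And>z. z \<in> ball 0 r \<Longrightarrow> (H has_field_derivative g z) (at z)"
    and HF: "H has_fps_expansion F" and gF: "g has_fps_expansion fps_deriv F"
    using holomorphic_primitive_fps[OF g_hol \<open>r > 0\<close>] by blast
  have F0: "fps_nth F 0 = 0"
    using has_fps_expansion_imp_0_eq_fps_nth_0[OF HF] H0_0 by simp
  have F1: "fps_nth F 1 = complex_of_real (f 0)"
    using has_fps_expansion_imp_0_eq_fps_nth_0[OF gF] g[of 0] by simp
  have cdf_H: "complex_of_real (cdf D x) = H (of_real x)" if "0 \<le> x" "x < r" for x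
    unfolding D_def using that g
    by (intro cdf_density_eq_primitive[where g = g] f_meas assms(4,5) H H0_0) auto

  let ?\<Psi> = "\<lambda>n t. \<integral>u. complex_of_real (cdf D (t * u) ^ n) \<partial>std_exponential"
  \<comment> \<open>Used with \<open>j = 1\<close> for the factors of the product and with
    \<open>k = 1\<close>, \<open>j = n\<close> for the maximum.\<close>
  have asymp: "asymp_fps (\<lambda>t. ?\<Psi> j (real k * t)) (fps_laplace (of_nat k) (F ^ j))" if "k \<ge> 1" for k j
    using asymp_fps_laplace[of "\<lambda>x. complex_of_real (cdf D x ^ j)" 1 "\<lambda>z. H z ^ j" "F ^ j" r "real k"]
      HF \<open>r > 0\<close> cdf_H that
    by (simp add: norm_power D.cdf_nonneg D.cdf_bounded_prob power_le_one has_fps_expansion_power)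
  have "asymp_fps (\<lambda>t. \<Prod>k=1..n. ?\<Psi> 1 (real k * t)) (\<Prod>k=1..n. fps_laplace (of_nat k) F)"
    using asymp[of _ 1] by (intro asymp_fps_prod) auto
  \<comment> \<open>One function of \<open>t > 0\<close> thus has two expansions, whose coefficients
    must agree.\<close>
  moreover have "(\<Prod>k=1..n. ?\<Psi> 1 (real k * t)) = ?\<Psi> n t" if "t > 0" for t
    using M.prod_integral_cdf_eq[OF assms(10) _ _ nonneg_D assms(12) that] assms(11) D_X \<open>2 \<le> n\<close>
    by (simp flip: of_real_prod del: of_real_power)
  ultimately have "asymp_fps (?\<Psi> n) (\<Prod>k=1..n. fps_laplace (of_nat k) F)"
    by (simp add: asymp_fps_def)
  then have "fps_laplace 1 (F ^ n) = (\<Prod>k=1..n. fps_laplace (of_nat k) F)"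
    using asymp[of 1 n] asymp_fps_unique by simp
  \<comment> \<open>Positivity of \<open>f 0\<close> provides the nonzero linear coefficient of
    \<open>F\<close>.\<close>
  then obtain b where "fps_deriv F = fps_const (complex_of_real (f 0)) * fps_exp b"
    using fps_laplace_power_eq_prod_imp[of F n] F0 F1 \<open>0 < f 0\<close> \<open>2 \<le> n\<close> by auto
  with gF have "g has_fps_expansion fps_const (complex_of_real (f 0)) * fps_exp b"
    by (simp only:)
  note g_exp = exponential_on_nonneg[OF S(1,2) g_S this]
  have f_exp: "complex_of_real (f x) = complex_of_real (f 0) * exp (b * of_real x)" if "x \<ge> 0" for x
    using g_exp[OF that] by (simp only: g[OF that])
  have "b \<in> \<real>"
    using \<open>0 < f 0\<close> by (intro real_exponential_rate[OF f_exp]) auto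
  then obtain \<beta> where b: "b = complex_of_real \<beta>" by (rule Reals_cases)
  have f_real: "f x = f 0 * exp (\<beta> * x)" if "x \<ge> 0" for x
    using f_exp[OF that] unfolding b of_real_mult[symmetric] exp_of_real of_real_eq_iff .
  obtain l where "l > 0" and f_l: "f = exponential_density l"
    using exponential_density_eqI[OF D.prob_space_axioms[unfolded D_def] f_real assms(5) \<open>0 < f 0\<close>] by blast
  show ?thesis
  proof (intro exI[of _ l] conjI allI impI)
    show "distributed N lborel X (\<lambda>x. ennreal (exponential_density l x))"
      using XN by (simp only: f_l)
    show "f x = l * exp (- l * x)" if "0 \<le> x" for x
      using that by (simp add: f_l exponential_density_def mult.commute)
  qed fact
qed

end
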